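(* Let $R$ be a complete Hausdorff non-archimedean commutative ring and let $q\in R$ be topologically nilpotent. Then $$(q;q)_\infty^3=\sum_{k\in\mathbb{N}}(-1)^k(2k+1)\,q^{\frac{k(k+1)}{2}}.$$
   Context: $\mathbb{N}$ contains $0$. A non-archimedean ring is a topological ring in which every neighborhood of $0$ contains an open additive subgroup. Completeness is with respect to the uniform structure of the additive group. An element $q$ is topologically nilpotent if $q^n\to 0$ as $n\to\infty$. The infinite $q$-Pochhammer symbol is $(a;q)_\infty:=\lim_{n\to\infty}\prod_{i=0}^{n-1}(1-aq^i)$. The infinite sum is the unconditional sum in $R$ (limit over finite subsets of the index set ordered by inclusion). *)

theory Defs
  imports "HOL-Analysis.Infinite_Sum"
begin

text \<open>
  The combination of \<open>comm_ring\<close> and \<open>comm_monoid_mult\<close> is a commutative ring with unit; unlike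
  \<open>comm_ring_1\<close> it does not require \<open>0 \<noteq> 1\<close>, so that the zero ring is included.
\<close>

class nonarchimedean_comm_ring =
  comm_ring + comm_monoid_mult + topological_ab_group_add + topological_semigroup_mult +
  assumes open_additive_subgroup:
    "open U \<Longrightarrow> 0 \<in> U \<Longrightarrow>
      \<exists>H. open H \<and> 0 \<in> H \<and> (\<forall>x\<in>H. \<forall>y\<in>H. x + y \<in> H) \<and> (\<forall>x\<in>H. - x \<in> H) \<and> H \<subseteq> U"

text \<open>
  The following lemma shows that the uniformity of a \<open>uniform_topological_group_add\<close> is the
  one of the additive group. Hence \<open>complete_uniform_space\<close> (every Cauchy filter converges) is
  completeness with respect to that uniform structure.
\<close>

lemma eventually_uniformity_add_iff:
  fixes E :: "'a::uniform_topological_group_add \<times> 'a \<Rightarrow> bool"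
  shows "eventually E uniformity \<longleftrightarrow> (\<exists>U. open U \<and> 0 \<in> U \<and> (\<forall>x y. x - y \<in> U \<longrightarrow> E (x, y)))"
proof -
  have translate: "\<exists>D. eventually D uniformity \<and> (\<forall>x y z. D (x, y) \<longrightarrow> F (x + z, y + z))"
    if "eventually F uniformity" for F :: "'a \<times> 'a \<Rightarrow> bool"
    using uniformly_continuous_add[where 'a='a] that
    unfolding uniformly_continuous_on_uniformity filterlim_def le_filter_def uniformity_prod_def
    by (simp add: case_prod_beta eventually_filtermap eventually_prod_same) (meson uniformity_refl)
  show ?thesis
  proof
    assume "eventually E uniformity"
    with translate obtain D
      where D: "eventually D uniformity" "\<And>x y z. D (x, y) \<Longrightarrow> E (x + z, y + z)" by blast
    have "eventually (\<lambda>y. D (y, 0)) (nhds 0)"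
      using uniformity_sym[OF D(1)] unfolding eventually_nhds_uniformity
      by (auto elim: eventually_mono)
    then obtain U where U: "open U" "0 \<in> U" "\<And>y. y \<in> U \<Longrightarrow> D (y, 0)"
      by (auto simp: eventually_nhds)
    have "E (x, y)" if "x - y \<in> U" for x y
      using D(2)[OF U(3)[OF that], of y] by simp
    with U show "\<exists>U. open U \<and> 0 \<in> U \<and> (\<forall>x y. x - y \<in> U \<longrightarrow> E (x, y))" by blast
  next
    assume "\<exists>U. open U \<and> 0 \<in> U \<and> (\<forall>x y. x - y \<in> U \<longrightarrow> E (x, y))"
    then obtain U where U: "open U" "0 \<in> U" "\<And>x y. x - y \<in> U \<Longrightarrow> E (x, y)" by blast
    then have "eventually (\<lambda>y. y \<in> U) (nhds 0)" by (auto simp: eventually_nhds)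
    then have "eventually (\<lambda>(x', y). x' = 0 \<longrightarrow> y \<in> U) uniformity"
      unfolding eventually_nhds_uniformity .
    from translate[OF this] obtain D where D: "eventually D uniformity"
      "\<And>x y z. D (x, y) \<Longrightarrow> x + z = 0 \<Longrightarrow> y + z \<in> U" by auto
    have "E (y, x)" if "D (x, y)" for x y
      using D(2)[OF that, of "- x"] U(3) by simp
    with uniformity_sym[OF D(1)] show "eventually E uniformity"
      by (auto elim!: eventually_mono)
  qed
qed

class complete_nonarchimedean_comm_ring =
  nonarchimedean_comm_ring + uniform_topological_group_add + complete_uniform_space + t2_space

definition topologically_nilpotent :: "'a::{monoid_mult, zero, topological_space} \<Rightarrow> bool" where
  "topologically_nilpotent q \<longleftrightarrow> (\<lambda>n. q ^ n) \<longlonglongrightarrow> 0"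

definition q_pochhammer :: "'a::{comm_ring, comm_monoid_mult} \<Rightarrow> 'a \<Rightarrow> nat \<Rightarrow> 'a" where
  "q_pochhammer a q n = (\<Prod>i<n. 1 - a * q ^ i)"

definition q_pochhammer_inf ::
    "'a::{comm_ring, comm_monoid_mult, t2_space} \<Rightarrow> 'a \<Rightarrow> 'a" where
  "q_pochhammer_inf a q = lim (\<lambda>n. q_pochhammer a q n)"

text \<open>The multiple \<open>n x = x + \<dots> + x\<close>; \<open>of_nat\<close> is not available without \<open>0 \<noteq> 1\<close>.\<close>

definition nat_multiple :: "nat \<Rightarrow> 'a::comm_monoid_add \<Rightarrow> 'a" where
  "nat_multiple n x = (\<Sum>i<n. x)"

end

(* Let x = q^n in the Gauss binomial theorem for the product of the x - z q^i over i < 2n+1 and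
   differentiate at z = 1. Only the factor i = n vanishes there, so this gives, after pairing k with
   2n+1-k, the finite identity
     (q;q)_n^2 = sum_{j<=n} (-1)^j (2j+1) q^(j(j+1)/2) [2n+1, n-j].
   Multiplied by (q;q)_n, the Gauss binomials become congruent to 1 modulo q^(n-j+1), so that Jacobi's
   identity holds modulo q^(n+1) in Z[q]. Since q is topologically nilpotent, every open subgroup of
   R contains the image of some q^N Z[q], even though it need not be an ideal. *)

theory Submission
  imports Defs "HOL-Computational_Algebra.Polynomial"
begin

section \<open>Gauss binomials, finite q-Pochhammer symbols and the Gauss binomial theorem\<close>

lemma add_choose_two: "(m + n) choose 2 = (m choose 2) + (n choose 2) + m * n"
  by (induction n) (simp_all add: numeral_2_eq_2)

text \<open>The q-Pascal rule serves as the definition because the quotient (q;q)_n / ((q;q)_k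
  (q;q)_(n-k)) makes no sense in a general ring.\<close>

fun gauss_binomial :: "'a::comm_ring_1 \<Rightarrow> nat \<Rightarrow> nat \<Rightarrow> 'a" where
  "gauss_binomial q n 0 = 1"
| "gauss_binomial q 0 (Suc k) = 0"
| "gauss_binomial q (Suc n) (Suc k) = gauss_binomial q n k + q ^ Suc k * gauss_binomial q n (Suc k)"

lemma gauss_binomial_eq_0: "n < k \<Longrightarrow> gauss_binomial q n k = 0"
  by (induction q n k rule: gauss_binomial.induct) auto

lemma q_pochhammer_Suc: "q_pochhammer a q (Suc n) = q_pochhammer a q n * (1 - a * q ^ n)"
  by (simp add: q_pochhammer_def)

lemma q_pochhammer_0: "q_pochhammer a q 0 = 1"
  by (simp add: q_pochhammer_def)

lemma q_pochhammer_add: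
  "q_pochhammer a q (m + n) = q_pochhammer a q m * q_pochhammer (a * q ^ m) q n"
  by (induction n) (simp_all add: q_pochhammer_0 q_pochhammer_Suc power_add mult_ac)

text \<open>The quotient formula with its denominators cleared. In the q-Pascal rule the two
  summands contribute 1 - q^k and q^k (1 - q^m) times (q;q)_(m+k-1), and these factors add up to 1 -
  q^(m+k).\<close>

lemma gauss_binomial_mult_q_pochhammer:
  fixes q :: "'a::comm_ring_1"
  shows "gauss_binomial q (m + k) k * (q_pochhammer q q k * q_pochhammer q q m) = q_pochhammer q q (m + k)"
proof (induction "m + k" arbitrary: m k)
  case 0
  then show ?case by (simp add: q_pochhammer_0)
next
  case (Suc n)
  show ?case
  proof (cases k)
    case 0
    then show ?thesis by (simp add: q_pochhammer_0)
  next
    case k: (Suc k')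
    have n: "n = m + k'" using Suc.hyps(2) k by simp
    have 1: "gauss_binomial q n k' * (q_pochhammer q q k' * q_pochhammer q q m) = q_pochhammer q q n"
      using Suc.hyps(1)[OF n] n by simp
    \<comment> \<open>The factor 1 - q^m covers \<open>m = 0\<close> as well: there
      \<open>n < k\<close>, so both sides vanish.\<close>
    have 2: "gauss_binomial q n k * (q_pochhammer q q k * q_pochhammer q q m)
        = (1 - q ^ m) * q_pochhammer q q n"
    proof (cases m)
      case 0
      then show ?thesis using n k by (simp add: gauss_binomial_eq_0)
    next
      case (Suc m')
      with n k have "n = m' + k" by simp
      note IH = Suc.hyps(1)[OF this, folded this]
      have "gauss_binomial q n k * (q_pochhammer q q k * q_pochhammer q q m)
        = (gauss_binomial q n k * (q_pochhammer q q k * q_pochhammer q q m')) * (1 - q ^ m)"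
        by (simp add: Suc q_pochhammer_Suc mult_ac)
      then show ?thesis
        unfolding IH by (simp add: mult.commute)
    qed
    have "gauss_binomial q (m + k) k * (q_pochhammer q q k * q_pochhammer q q m)
      = (1 - q ^ k) * (gauss_binomial q n k' * (q_pochhammer q q k' * q_pochhammer q q m))
        + q ^ k * (gauss_binomial q n k * (q_pochhammer q q k * q_pochhammer q q m))"
      by (simp add: k n q_pochhammer_Suc algebra_simps)
    also have "\<dots> = q_pochhammer q q n * (1 - q ^ (m + k))"
      unfolding 1 2 by (simp add: algebra_simps power_add)
    also have "\<dots> = q_pochhammer q q (m + k)"
      by (simp add: k n q_pochhammer_Suc)
    finally show ?thesis .
  qed
qed

text \<open>Splitting off the factor i = 0 leaves the same product with \<open>z * q\<close> in
  place of \<open>z\<close>, hence the induction with \<open>z\<close> arbitrary. Keeping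
  \<open>x\<close> general allows x = q^n later.\<close>

lemma gauss_binomial_theorem:
  fixes x z q :: "'a::comm_ring_1"
  shows "(\<Prod>i<n. x + z * q ^ i)
    = (\<Sum>k\<le>n. q ^ (k choose 2) * gauss_binomial q n k * z ^ k * x ^ (n - k))"
proof (induction n arbitrary: z)
  case 0
  then show ?case by (simp add: numeral_2_eq_2)
next
  case (Suc n)
  define c where "c k = q ^ (k choose 2) * gauss_binomial q n k * (z * q) ^ k * x ^ (n - k)" for k
  \<comment> \<open>This vanishing term extends the sum multiplied by \<open>x\<close> to
    \<open>Suc n\<close>, so that after an index shift it lines up with the sum multiplied by
    \<open>z\<close>.\<close>
  have c0: "c (Suc n) = 0" by (simp add: c_def gauss_binomial_eq_0)
  have "(\<Prod>i<Suc n. x + z * q ^ i) = (x + z) * (\<Prod>i<n. x + (z * q) * q ^ i)"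
    unfolding prod.lessThan_Suc_shift by (simp add: mult_ac)
  also have "\<dots> = (x + z) * (\<Sum>k\<le>n. c k)"
    unfolding Suc.IH c_def ..
  also have "\<dots> = x * (\<Sum>k\<le>Suc n. c k) + z * (\<Sum>k\<le>n. c k)"
    by (simp add: c0 algebra_simps)
  also have "\<dots> = x * c 0 + (\<Sum>k\<le>n. x * c (Suc k) + z * c k)"
    unfolding sum.atMost_Suc_shift by (simp add: sum.distrib sum_distrib_left algebra_simps)
  also have "(\<Sum>k\<le>n. x * c (Suc k) + z * c k) = (\<Sum>k\<le>n. q ^ (Suc k choose 2) *
      gauss_binomial q (Suc n) (Suc k) * z ^ Suc k * x ^ (Suc n - Suc k))"
  proof (rule sum.cong[OF refl])
    fix k assume "k \<in> {..n}"
    then have k: "k \<le> n" by simp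
    have e: "q ^ (Suc k choose 2) = q ^ (k choose 2) * q ^ k"
      by (simp add: numeral_2_eq_2 add.commute flip: power_add)
    \<comment> \<open>For \<open>k = n\<close> the truncated exponent \<open>n - Suc k\<close> is
      off by one, but then the Gauss binomial is 0 on both sides.\<close>
    have "x * c (Suc k) = q ^ (Suc k choose 2) * (q ^ Suc k * gauss_binomial q n (Suc k))
        * z ^ Suc k * x ^ (n - k)"
    proof (cases "k = n")
      case True
      then show ?thesis by (simp add: c0 gauss_binomial_eq_0)
    next
      case False
      with k have "n - k = Suc (n - Suc k)" by simp
      then show ?thesis by (simp add: c_def power_mult_distrib mult_ac)
    qed
    moreover have "z * c k = q ^ (Suc k choose 2) * gauss_binomial q n k * z ^ Suc k * x ^ (n - k)"
      unfolding e by (simp add: c_def power_mult_distrib mult_ac)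
    ultimately show "x * c (Suc k) + z * c k = q ^ (Suc k choose 2) *
      gauss_binomial q (Suc n) (Suc k) * z ^ Suc k * x ^ (Suc n - Suc k)"
      by (simp add: algebra_simps)
  qed
  also have "x * c 0 + \<dots> = (\<Sum>k\<le>Suc n. q ^ (k choose 2) * gauss_binomial q (Suc n) k * z ^ k * x ^ (Suc n - k))"
    unfolding sum.atMost_Suc_shift by (simp add: c_def numeral_2_eq_2)
  finally show ?case .
qed

section \<open>The finite form of Jacobi's identity\<close>

lemma gauss_binomial_const_poly: "gauss_binomial [:q:] n k = [:gauss_binomial q n k:]"
  by (induction q n k rule: gauss_binomial.induct) (simp_all add: poly_const_pow one_pCons)

lemma q_pochhammer_neq_0:
  fixes q :: "'a::idom"
  assumes "\<forall>m>0. q ^ m \<noteq> 1"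
  shows "q_pochhammer q q n \<noteq> 0"
proof -
  have "q * q ^ i \<noteq> 1" for i
    using assms unfolding power_Suc[symmetric] by blast
  then show ?thesis by (auto simp: q_pochhammer_def)
qed

text \<open>The q-Pascal rule hides the symmetry, but the product formula shows it: both sides times
  (q;q)_k (q;q)_m equal (q;q)_(m+k). The factors cancel in a domain when q is not a root of
  unity.\<close>

lemma gauss_binomial_symmetric:
  fixes q :: "'a::idom"
  assumes "\<forall>m>0. q ^ m \<noteq> 1"
  shows "gauss_binomial q (m + k) k = gauss_binomial q (m + k) m"
  using gauss_binomial_mult_q_pochhammer[of q m k] gauss_binomial_mult_q_pochhammer[of q k m]
    q_pochhammer_neq_0[OF assms]
  by (simp add: add.commute mult.commute) (metis mult_right_cancel mult_eq_0_iff)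

lemma pderiv_sum: "pderiv (\<Sum>i\<in>A. f i) = (\<Sum>i\<in>A. pderiv (f i))"
  by (induction A rule: infinite_finite_induct) (simp_all add: pderiv_add)

text \<open>Two evaluations of one derivative at z = 1: on the left termwise after expansion, on the
  right by the product rule, where -(q^n) is the derivative of the vanishing factor i = n.\<close>

lemma weighted_gauss_binomial_sum:
  fixes q :: "'a::{idom,ring_char_0}"
  shows "(\<Sum>k\<le>2*n+1. of_nat k * ((- 1) ^ k * q ^ ((k choose 2) + n * (2 * n + 1 - k))
            * gauss_binomial q (2 * n + 1) k))
    = - (q ^ n) * (\<Prod>i\<in>{..<2*n+1}-{n}. q ^ n - q ^ i)"
proof -
  define f where "f = (\<Prod>i<2*n+1. [:q ^ n, - (q ^ i):])"
  define g where "g = (\<Prod>i\<in>{..<2*n+1}-{n}. [:q ^ n, - (q ^ i):])"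
  have "f = [:q ^ n, - (q ^ n):] * g"
    unfolding f_def g_def by (rule prod.remove) auto
  then have "poly (pderiv f) 1 = - (q ^ n) * poly g 1"
    by (simp add: pderiv_mult pderiv_pCons del: mult_pCons_left)
  moreover have "poly g 1 = (\<Prod>i\<in>{..<2*n+1}-{n}. q ^ n - q ^ i)"
    by (simp add: g_def poly_prod)
  moreover have "poly (pderiv f) 1 = (\<Sum>k\<le>2*n+1. of_nat k * ((- 1) ^ k * q ^ ((k choose 2) + n * (2 * n + 1 - k))
            * gauss_binomial q (2 * n + 1) k))"
  proof -
    \<comment> \<open>The binomial theorem is applied in the polynomial ring in z, with -z as its
      second variable and \<open>q\<close> as the constant \<open>[:q:]\<close>.\<close>
    have "f = (\<Prod>i<2*n+1. [:q ^ n:] + [:0, - 1:] * [:q:] ^ i)"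
      by (simp add: f_def poly_const_pow)
    also have "\<dots> = (\<Sum>k\<le>2*n+1. monom ((- 1) ^ k * q ^ ((k choose 2) + n * (2 * n + 1 - k))
              * gauss_binomial q (2 * n + 1) k) k)"
    proof -
      have z: "[:0, - 1:] ^ k = monom ((- 1) ^ k :: 'a) k" for k
        by (induction k) (simp_all add: monom_Suc monom_0 one_pCons minus_monom)
      show ?thesis
        unfolding gauss_binomial_theorem
        unfolding gauss_binomial_const_poly poly_const_pow z
        by (intro sum.cong refl) (simp add: smult_monom power_add power_mult mult_ac)
    qed
    finally show ?thesis
      by (simp add: pderiv_sum pderiv_monom poly_sum poly_monom del: sum.atMost_Suc)
  qed
  ultimately show ?thesis by simp
qed

text \<open>The terms k = n - j and k = n + 1 + j carry the same power of q and the same Gauss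
  binomial but opposite signs, so their weights combine to (n + 1 + j) - (n - j) = 2j + 1. A common
  power of q then cancels.\<close>

lemma finite_jacobi:
  fixes q :: "'a::{idom,ring_char_0}"
  assumes "q \<noteq> 0" and q1: "\<forall>m>0. q ^ m \<noteq> 1"
  shows "q_pochhammer q q n ^ 2
    = (\<Sum>j\<le>n. (- 1) ^ j * of_nat (2 * j + 1) * q ^ (Suc j choose 2) * gauss_binomial q (2 * n + 1) (n - j))"
proof -
  \<comment> \<open>The exponent collects \<open>n choose 2\<close> from the factors with i < n,
    \<open>n\<close> from the differentiated factor and \<open>n * n\<close> from the factors with i
    > n.\<close>
  define E where "E = (n choose 2) + n + n * n"
  define t where "t k = of_nat k * ((- 1) ^ k * q ^ ((k choose 2) + n * (2 * n + 1 - k))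
            * gauss_binomial q (2 * n + 1) k)" for k
  have "(\<Prod>i\<in>{..<2*n+1}-{n}. q ^ n - q ^ i) = (\<Prod>i<n. q ^ n - q ^ i) * (\<Prod>i=n+1..<2*n+1. q ^ n - q ^ i)"
    by (subst prod.union_disjoint[symmetric]) (auto intro!: prod.cong)
  also have "(\<Prod>i<n. q ^ n - q ^ i) = (- 1) ^ n * q ^ (n choose 2) * q_pochhammer q q n"
  proof -
    \<comment> \<open>Factoring out -(q^i) leaves 1 - q^(n-i), the factors of (q;q)_n in reverse
      order.\<close>
    have "(\<Prod>i<n. q ^ n - q ^ i) = (\<Prod>i<n. - 1 * q ^ i * (1 - q * q ^ (n - Suc i)))"
      by (intro prod.cong refl) (simp add: algebra_simps flip: power_add power_Suc)
    also have "\<dots> = (- 1) ^ n * q ^ (\<Sum>i<n. i) * (\<Prod>i<n. 1 - q * q ^ (n - Suc i))"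
      by (simp only: prod.distrib power_sum prod_constant card_lessThan)
    also have "(\<Prod>i<n. 1 - q * q ^ (n - Suc i)) = q_pochhammer q q n"
      unfolding q_pochhammer_def by (rule prod.nat_diff_reindex)
    also have "(\<Sum>i<n. i) = n choose 2"
      by (induction n) (simp_all add: numeral_2_eq_2)
    finally show ?thesis .
  qed
  also have "(\<Prod>i=n+1..<2*n+1. q ^ n - q ^ i) = q ^ (n * n) * q_pochhammer q q n"
  proof -
    have "(\<Prod>i=n+1..<2*n+1. q ^ n - q ^ i) = (\<Prod>i<n. q ^ n - q ^ (i + (n + 1)))"
      using prod.shift_bounds_nat_ivl[of "\<lambda>i. q ^ n - q ^ i" 0 "n+1" n]
      by (simp add: lessThan_atLeast0 mult_2)
    also have "\<dots> = (\<Prod>i<n. q ^ n * (1 - q * q ^ i))"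
      by (intro prod.cong refl) (simp add: algebra_simps power_add)
    finally show ?thesis
      by (simp add: prod.distrib q_pochhammer_def power_mult)
  qed
  finally have "(\<Sum>k\<le>2*n+1. t k) = - (q ^ n) * ((- 1) ^ n * q ^ (n choose 2) * q_pochhammer q q n *
      (q ^ (n * n) * q_pochhammer q q n))"
    unfolding t_def weighted_gauss_binomial_sum by simp
  also have "\<dots> = - ((- 1) ^ n) * q ^ E * q_pochhammer q q n ^ 2"
    by (simp add: E_def power_add power2_eq_square mult_ac)
  finally have lhs: "(\<Sum>k\<le>2*n+1. t k) = - ((- 1) ^ n) * q ^ E * q_pochhammer q q n ^ 2" .
  \<comment> \<open>The sum is cut in the middle; reversing the lower half makes j the distance from
    the cut on both sides.\<close>
  have "{..2*n+1} = {..<n+1} \<union> {n+1..<2*n+2}" by auto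
  then have "(\<Sum>k\<le>2*n+1. t k) = (\<Sum>k<n+1. t k) + (\<Sum>k=n+1..<2*n+2. t k)"
    by (simp only:) (rule sum.union_disjoint; auto)
  also have "(\<Sum>k<n+1. t k) = (\<Sum>j<n+1. t (n - j))"
    using sum.nat_diff_reindex[of t "n+1"] by simp
  also have "(\<Sum>k=n+1..<2*n+2. t k) = (\<Sum>j<n+1. t (j + (n + 1)))"
    using sum.shift_bounds_nat_ivl[of t 0 "n+1" "n+1"] by (simp add: lessThan_atLeast0 mult_2)
  also have "(\<Sum>j<n+1. t (n - j)) + \<dots> = (\<Sum>j\<le>n. t (n - j) + t (n + 1 + j))"
    by (simp add: sum.distrib lessThan_Suc_atMost add_ac)
  also have "\<dots> = (\<Sum>j\<le>n. - ((- 1) ^ n) * q ^ E * ((- 1) ^ j * of_nat (2 * j + 1)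
      * q ^ (Suc j choose 2) * gauss_binomial q (2 * n + 1) (n - j)))"
  proof (rule sum.cong[OF refl])
    fix j assume "j \<in> {..n}"
    then obtain m where m: "n = m + j" using le_Suc_ex[of j n] by (auto simp: add.commute)
    \<comment> \<open>The one quadratic relation needed to match the exponents in \<open>e1\<close>
      and \<open>e2\<close>.\<close>
    have sq: "j * j = j + (j choose 2) + (j choose 2)"
      by (induction j) (simp_all add: numeral_2_eq_2)
    have s: "Suc j choose 2 = (j choose 2) + j" by (simp add: numeral_2_eq_2)
    have e1: "((n - j) choose 2) + n * (2 * n + 1 - (n - j)) = E + (Suc j choose 2)"
      unfolding E_def m s using sq by (simp add: add_choose_two algebra_simps)
    have n1: "n + 1 + j = n + Suc j" by simp
    have e2: "((n + 1 + j) choose 2) + n * (2 * n + 1 - (n + 1 + j)) = E + (Suc j choose 2)"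
      unfolding E_def n1 add_choose_two[of n] using sq by (simp add: m algebra_simps)
    have b: "gauss_binomial q (2 * n + 1) (n + 1 + j) = gauss_binomial q (2 * n + 1) (n - j)"
    proof -
      have "2 * n + 1 = (n - j) + (n + 1 + j)" by (simp add: m)
      then show ?thesis using gauss_binomial_symmetric[OF q1] by (simp only:)
    qed
    \<comment> \<open>Since n = m + j, this reduces (-1)^n (-1)^j to (-1)^m, the sign of
      \<open>t (n - j)\<close>.\<close>
    have p2: "(- 1) ^ j * ((- 1) ^ j * x) = x" for x :: 'a
      by (simp add: mult.assoc[symmetric] power_add[symmetric])
    show "t (n - j) + t (n + 1 + j) = - ((- 1) ^ n) * q ^ E * ((- 1) ^ j * of_nat (2 * j + 1)
      * q ^ (Suc j choose 2) * gauss_binomial q (2 * n + 1) (n - j))"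
      unfolding t_def e1 e2 b unfolding m power_add
      by (simp add: p2 algebra_simps)
  qed
  finally show ?thesis
    unfolding lhs sum_distrib_left[symmetric] using \<open>q \<noteq> 0\<close> by simp
qed

section \<open>Congruences modulo powers of q\<close>

lemma dvd_q_pochhammer_minus_1:
  fixes a q :: "'a::comm_ring_1"
  shows "a dvd q_pochhammer a q n - 1"
proof (induction n)
  case 0
  then show ?case by (simp add: q_pochhammer_0)
next
  case (Suc n)
  have "q_pochhammer a q (Suc n) - 1 = (q_pochhammer a q n - 1) - a * (q ^ n * q_pochhammer a q n)"
    by (simp add: q_pochhammer_Suc algebra_simps)
  with Suc show ?case by (metis dvd_diff dvd_triv_left)
qed

lemma dvd_mult_minus_1:
  fixes a b d :: "'a::comm_ring_1"
  assumes "d dvd a - 1" "d dvd b - 1"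
  shows "d dvd a * b - 1"
proof -
  have "a * b - 1 = a * (b - 1) + (a - 1)" by (simp add: algebra_simps)
  then show ?thesis
    using assms dvd_add dvd_mult by metis
qed

text \<open>Put m = n - j. Cancelling (q;q)_(n+1+j) in the product formula turns the Gauss binomial
  times (q;q)_m into (q^(n+j+2);q)_m. The rest of (q;q)_n is (q^(m+1);q)_j. All factors of both
  products are 1 modulo q^(m+1).\<close>

lemma dvd_gauss_binomial_mult_q_pochhammer_minus_1:
  fixes q :: "'a::idom"
  assumes q1: "\<forall>m>0. q ^ m \<noteq> 1" and "j \<le> n"
  shows "q ^ (n - j + 1) dvd gauss_binomial q (2 * n + 1) (n - j) * q_pochhammer q q n - 1"
proof -
  obtain m where m: "n = m + j" using le_Suc_ex[OF \<open>j \<le> n\<close>] by (auto simp: add.commute)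
  define b where "b = gauss_binomial q (2 * n + 1) m"
  have e: "n + 1 + j + m = 2 * n + 1" by (simp add: m)
  have "q_pochhammer q q (n + 1 + j) * (b * q_pochhammer q q m)
      = q_pochhammer q q (n + 1 + j) * q_pochhammer (q * q ^ (n + 1 + j)) q m"
    using gauss_binomial_mult_q_pochhammer[of q "n + 1 + j" m]
    unfolding q_pochhammer_add[of q q "n + 1 + j" m, symmetric] e b_def by (simp only: mult_ac)
  with q_pochhammer_neq_0[OF q1] have A: "b * q_pochhammer q q m = q_pochhammer (q * q ^ (n + 1 + j)) q m" by simp
  have "q ^ (m + 1) dvd q * q ^ (n + 1 + j)"
    unfolding power_Suc[symmetric] by (rule le_imp_power_dvd) (simp add: m)
  then have "q ^ (m + 1) dvd b * q_pochhammer q q m - 1"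
    unfolding A using dvd_q_pochhammer_minus_1 dvd_trans by blast
  moreover have "q ^ (m + 1) dvd q_pochhammer (q * q ^ m) q j - 1"
    using dvd_q_pochhammer_minus_1[of "q * q ^ m"] by simp
  ultimately have "q ^ (m + 1) dvd (b * q_pochhammer q q m) * q_pochhammer (q * q ^ m) q j - 1"
    by (rule dvd_mult_minus_1)
  then show ?thesis
    by (simp add: m q_pochhammer_add b_def mult_ac)
qed

text \<open>Replacing the j-th Gauss binomial times (q;q)_n by 1 costs a multiple of q^(n-j+1); the
  prefactor q^(j(j+1)/2) supplies the missing q^j.\<close>

lemma jacobi_cong:
  fixes q :: "'a::{idom,ring_char_0}"
  assumes "q \<noteq> 0" and q1: "\<forall>m>0. q ^ m \<noteq> 1"
  shows "q ^ (n + 1) dvd q_pochhammer q q n ^ 3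
    - (\<Sum>j\<le>n. (- 1) ^ j * of_nat (2 * j + 1) * q ^ (Suc j choose 2))"
proof -
  define c where "c j = (- 1) ^ j * (of_nat (2 * j + 1) :: 'a)" for j
  define g where "g j = gauss_binomial q (2 * n + 1) (n - j)" for j
  have "q_pochhammer q q n ^ 3 = q_pochhammer q q n ^ 2 * q_pochhammer q q n"
    by (simp add: eval_nat_numeral)
  also have "\<dots> = (\<Sum>j\<le>n. c j * q ^ (Suc j choose 2) * (g j * q_pochhammer q q n))"
    unfolding finite_jacobi[OF assms] c_def g_def sum_distrib_right by (simp only: mult.assoc)
  finally have "q_pochhammer q q n ^ 3 - (\<Sum>j\<le>n. c j * q ^ (Suc j choose 2))
      = (\<Sum>j\<le>n. c j * (q ^ (Suc j choose 2) * (g j * q_pochhammer q q n - 1)))"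
    by (simp add: sum_subtractf[symmetric] algebra_simps)
  moreover have "q ^ (n + 1) dvd c j * (q ^ (Suc j choose 2) * (g j * q_pochhammer q q n - 1))"
    if "j \<le> n" for j
  proof -
    have "j \<le> Suc j choose 2" by (simp add: numeral_2_eq_2)
    with that have "q ^ (n + 1) dvd q ^ (Suc j choose 2) * q ^ (n - j + 1)"
      unfolding power_add[symmetric] by (intro le_imp_power_dvd) simp
    also have "\<dots> dvd q ^ (Suc j choose 2) * (g j * q_pochhammer q q n - 1)"
      unfolding g_def
      by (intro mult_dvd_mono dvd_refl dvd_gauss_binomial_mult_q_pochhammer_minus_1[OF q1 that])
    finally show ?thesis by (rule dvd_mult)
  qed
  ultimately have "q ^ (n + 1) dvd q_pochhammer q q n ^ 3 - (\<Sum>j\<le>n. c j * q ^ (Suc j choose 2))"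
    by (simp only:) (rule dvd_sum, simp only: atMost_iff)
  then show ?thesis unfolding c_def .
qed

section \<open>Evaluation of integer polynomials in a possibly zero ring\<close>

lemma nat_multiple_0 [simp]: "nat_multiple 0 x = 0"
  by (simp add: nat_multiple_def)

lemma nat_multiple_Suc [simp]: "nat_multiple (Suc n) x = nat_multiple n x + x"
  by (simp add: nat_multiple_def add.commute)

lemma nat_multiple_add: "nat_multiple (m + n) x = nat_multiple m x + nat_multiple n x"
  by (induction n) (simp_all add: add_ac)

lemma nat_multiple_1_mult:
  fixes x :: "'a::{comm_ring,comm_monoid_mult}"
  shows "nat_multiple n 1 * x = nat_multiple n x"
  by (induction n) (simp_all add: distrib_right)

lemma nat_multiple_mult:
  fixes x :: "'a::{comm_ring,comm_monoid_mult}"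
  shows "nat_multiple (m * n) x = nat_multiple m 1 * nat_multiple n x"
  by (induction m) (simp_all add: nat_multiple_add distrib_right add.commute)

text \<open>The canonical ring homomorphism from the integers. As \<open>nat\<close> sends negative
  integers to 0, at least one of the two multiples is empty.\<close>

definition int_multiple :: "int \<Rightarrow> 'a::{comm_ring,comm_monoid_mult}" where
  "int_multiple k = nat_multiple (nat k) 1 - nat_multiple (nat (- k)) 1"

text \<open>Allows any representation of an integer as a difference, which reduces additivity and
  multiplicativity to natural multiples.\<close>

lemma int_multiple_diff: "int_multiple (int m - int n) = nat_multiple m 1 - nat_multiple n 1"
proof (cases "n \<le> m")
  case True
  then obtain d where "m = n + d" using le_Suc_ex by blast
  then show ?thesis by (simp add: int_multiple_def nat_multiple_add)
next
  case False
  then obtain d where "n = m + d" using le_Suc_ex[of m n] by auto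
  then show ?thesis by (simp add: int_multiple_def nat_multiple_add)
qed

lemma int_multiple_0 [simp]: "int_multiple 0 = 0"
  by (simp add: int_multiple_def)

lemma int_multiple_1 [simp]: "int_multiple 1 = 1"
  by (simp add: int_multiple_def)

lemma int_multiple_add: "int_multiple (a + b) = int_multiple a + int_multiple b"
proof -
  obtain m n m' n' where ab: "a = int m - int n" "b = int m' - int n'" by (metis int_diff_cases)
  have "a + b = int (m + m') - int (n + n')" by (simp add: ab)
  then show ?thesis
    unfolding ab by (simp only: int_multiple_diff nat_multiple_add) simp
qed

lemma int_multiple_mult: "int_multiple (a * b) = int_multiple a * int_multiple b"
proof -
  obtain m n m' n' where ab: "a = int m - int n" "b = int m' - int n'" by (metis int_diff_cases)
  have "a * b = int (m * m' + n * n') - int (m * n' + n * m')" by (simp add: ab algebra_simps)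
  then show ?thesis
    unfolding ab by (simp only: int_multiple_diff nat_multiple_add nat_multiple_mult)
      (simp add: algebra_simps)
qed

text \<open>\<open>poly (map_poly of_int p) q\<close> is not available without \<open>0 \<noteq> 1\<close>.\<close>

definition int_poly_eval :: "'a::{comm_ring,comm_monoid_mult} \<Rightarrow> int poly \<Rightarrow> 'a" where
  "int_poly_eval q p = fold_coeffs (\<lambda>a b. int_multiple a + q * b) p 0"

lemma int_poly_eval_0 [simp]: "int_poly_eval q 0 = 0"
  by (simp add: int_poly_eval_def)

lemma int_poly_eval_pCons [simp]:
  "int_poly_eval q (pCons a p) = int_multiple a + q * int_poly_eval q p"
  by (cases "p = 0 \<and> a = 0") (auto simp: int_poly_eval_def)

lemma int_poly_eval_1 [simp]: "int_poly_eval q 1 = 1"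
  by (simp add: one_pCons)

lemma int_poly_eval_add: "int_poly_eval q (p + r) = int_poly_eval q p + int_poly_eval q r"
  by (induction p r rule: poly_induct2) (simp_all add: int_multiple_add algebra_simps)

lemma int_poly_eval_minus: "int_poly_eval q (- p) = - int_poly_eval q p"
  using int_poly_eval_add[of q p "- p"] by (simp add: eq_neg_iff_add_eq_0 add.commute)

lemma int_poly_eval_diff: "int_poly_eval q (p - r) = int_poly_eval q p - int_poly_eval q r"
  using int_poly_eval_add[of q p "- r"] by (simp add: int_poly_eval_minus)

lemma int_poly_eval_smult: "int_poly_eval q (smult a p) = int_multiple a * int_poly_eval q p"
  by (induction p) (simp_all add: int_multiple_mult algebra_simps)

lemma int_poly_eval_mult: "int_poly_eval q (p * r) = int_poly_eval q p * int_poly_eval q r"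
  by (induction p) (simp_all add: int_poly_eval_add int_poly_eval_smult algebra_simps)

lemma int_poly_eval_power: "int_poly_eval q (p ^ n) = int_poly_eval q p ^ n"
  by (induction n) (simp_all add: int_poly_eval_mult)

lemma int_poly_eval_sum: "int_poly_eval q (\<Sum>i\<in>A. f i) = (\<Sum>i\<in>A. int_poly_eval q (f i))"
  by (induction A rule: infinite_finite_induct) (simp_all add: int_poly_eval_add)

lemma int_poly_eval_of_nat: "int_poly_eval q (of_nat n) = nat_multiple n 1"
  by (induction n) (simp_all add: int_poly_eval_add add.commute)

lemma int_poly_eval_X: "int_poly_eval q [:0, 1:] = q"
  by simp

text \<open>With \<open>a\<close> and \<open>b\<close> both the indeterminate X, this sends (X;X)_n
  to (q;q)_n. Cancellation thus takes place in the domain Z[X], and only its consequences are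
  carried over to R.\<close>

lemma int_poly_eval_q_pochhammer:
  "int_poly_eval q (q_pochhammer a b n) = q_pochhammer (int_poly_eval q a) (int_poly_eval q b) n"
  by (induction n)
    (simp_all add: q_pochhammer_0 q_pochhammer_Suc int_poly_eval_mult int_poly_eval_diff int_poly_eval_power)

text \<open>\<open>H\<close> need not absorb multiplication by ring elements. But a multiple of X^n
  evaluates to an integer combination of powers \<open>q ^ m\<close> with \<open>m \<ge> n\<close>,
  and an additive subgroup contains that.\<close>

lemma int_poly_eval_mem_subgroup:
  assumes "0 \<in> H" "\<forall>x\<in>H. \<forall>y\<in>H. x + y \<in> H" "\<forall>x\<in>H. - x \<in> H"
    and "\<And>m. m \<ge> n \<Longrightarrow> q ^ m \<in> H" and "[:0, 1:] ^ n dvd p"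
  shows "int_poly_eval q p \<in> H"
proof -
  have nat: "nat_multiple k x \<in> H" if "x \<in> H" for k x
    using that by (induction k) (auto simp: assms)
  have mult: "int_multiple a * x \<in> H" if "x \<in> H" for a x
    unfolding int_multiple_def left_diff_distrib nat_multiple_1_mult
    using nat[OF that] assms(2,3) unfolding diff_conv_add_uminus by blast
  \<comment> \<open>The exponent \<open>m\<close> stays arbitrary because removing the constant
    coefficient raises it by one.\<close>
  have "q ^ m * int_poly_eval q r \<in> H" if "m \<ge> n" for m r
    using that
  proof (induction r arbitrary: m)
    case 0
    then show ?case using assms(1) by simp
  next
    case (pCons a r)
    have "q ^ m * int_poly_eval q (pCons a r)
        = int_multiple a * q ^ m + q ^ Suc m * int_poly_eval q r"
      by (simp add: algebra_simps)
    then show ?case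
      using assms(2) mult[OF assms(4)[OF pCons.prems]] pCons.IH[of "Suc m"] pCons.prems by simp
  qed
  moreover obtain r where "p = [:0, 1:] ^ n * r" using assms(5) by blast
  ultimately show ?thesis
    by (simp add: int_poly_eval_mult int_poly_eval_power)
qed

section \<open>Topological nilpotence and convergence of (q;q)_n\<close>

lemma topologically_nilpotent_int_poly_eval:
  fixes q :: "'a::nonarchimedean_comm_ring"
  assumes "topologically_nilpotent q" "open U" "0 \<in> U"
  obtains n where "\<And>p. [:0, 1:] ^ n dvd p \<Longrightarrow> int_poly_eval q p \<in> U"
proof -
  obtain H where H: "open H" "0 \<in> H" "\<forall>x\<in>H. \<forall>y\<in>H. x + y \<in> H"
    "\<forall>x\<in>H. - x \<in> H" "H \<subseteq> U"
    using open_additive_subgroup[OF assms(2,3)] by blast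
  obtain n where "\<And>m. m \<ge> n \<Longrightarrow> q ^ m \<in> H"
    using topological_tendstoD[OF assms(1)[unfolded topologically_nilpotent_def] H(1,2)]
    unfolding eventually_sequentially by blast
  then have "int_poly_eval q p \<in> U" if "[:0, 1:] ^ n dvd p" for p
    using int_poly_eval_mem_subgroup[OF H(2-4) _ that] H(5) by blast
  with that show thesis .
qed

text \<open>For n \<ge> N, (X;X)_n is (X;X)_N times (X^(N+1);X)_(n-N), hence congruent to (X;X)_N
  modulo X^N. Evaluation makes the sequence Cauchy, and completeness gives the limit.\<close>

lemma convergent_q_pochhammer:
  fixes q :: "'a::complete_nonarchimedean_comm_ring"
  assumes "topologically_nilpotent q"
  shows "convergent (\<lambda>n. q_pochhammer q q n)"
proof -
  let ?X = "[:0, 1:] :: int poly"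
  have "Cauchy (\<lambda>n. q_pochhammer q q n)"
    unfolding Cauchy_uniform_iff eventually_uniformity_add_iff
  proof (intro allI impI, elim exE conjE)
    fix E :: "'a \<times> 'a \<Rightarrow> bool" and U
    assume U: "open U" "0 \<in> U" "\<forall>x y. x - y \<in> U \<longrightarrow> E (x, y)"
    obtain N where N: "\<And>p. ?X ^ N dvd p \<Longrightarrow> int_poly_eval q p \<in> U"
      using topologically_nilpotent_int_poly_eval[OF assms U(1,2)] by metis
    have 1: "?X ^ N dvd q_pochhammer ?X ?X n - q_pochhammer ?X ?X N" if le: "n \<ge> N" for n
    proof -
      obtain d where d: "n = N + d" using le_Suc_ex[OF le] by blast
      have "q_pochhammer ?X ?X n - q_pochhammer ?X ?X N
          = q_pochhammer ?X ?X N * (q_pochhammer (?X * ?X ^ N) ?X d - 1)"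
        unfolding d q_pochhammer_add by (simp only: right_diff_distrib mult_1_right)
      moreover have "?X ^ N dvd q_pochhammer (?X * ?X ^ N) ?X d - 1"
        using dvd_q_pochhammer_minus_1 by (rule dvd_mult_right)
      ultimately show ?thesis by (simp only: dvd_mult)
    qed
    have "q_pochhammer q q n - q_pochhammer q q m \<in> U" if "n \<ge> N" "m \<ge> N" for n m
    proof -
      have "?X ^ N dvd q_pochhammer ?X ?X n - q_pochhammer ?X ?X m"
        using dvd_diff[OF 1[OF that(1)] 1[OF that(2)]] by (simp only: diff_diff_eq2 diff_add_cancel)
      from N[OF this] show ?thesis
        by (simp only: int_poly_eval_diff int_poly_eval_q_pochhammer int_poly_eval_X)
    qed
    then show "\<exists>N. \<forall>n\<ge>N. \<forall>m\<ge>N. E (q_pochhammer q q n, q_pochhammer q q m)"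
      using U(3) by blast
  qed
  then show ?thesis
    unfolding Cauchy_uniform convergent_def filterlim_def
    using cauchy_filter_convergent by (auto simp: convergent_filter_iff)
qed

section \<open>Passage to the infinite sum\<close>

lemma jacobi_has_sum:
  fixes q :: "'a::complete_nonarchimedean_comm_ring"
  assumes "topologically_nilpotent q" and L: "(\<lambda>n. q_pochhammer q q n) \<longlonglongrightarrow> L"
  shows "((\<lambda>k::nat. (- 1) ^ k * nat_multiple (2 * k + 1) (q ^ (k * (k + 1) div 2))) has_sum L ^ 3) UNIV"
proof -
  let ?X = "[:0, 1:] :: int poly"
  define t where "t k = (- 1) ^ k * of_nat (2 * k + 1) * ?X ^ (Suc k choose 2)" for k
  \<comment> \<open>The hypotheses of \<open>jacobi_cong\<close> hold for X, since X^m has degree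
    m.\<close>
  have X: "?X \<noteq> 0" "\<forall>m>0. ?X ^ m \<noteq> 1"
    using degree_linear_power[of "0::int"] by (auto, metis degree_1 less_irrefl)
  have t: "(- 1) ^ k * nat_multiple (2 * k + 1) (q ^ (k * (k + 1) div 2)) = int_poly_eval q (t k)" for k
    unfolding t_def int_poly_eval_mult int_poly_eval_power int_poly_eval_minus int_poly_eval_of_nat
      int_poly_eval_1 int_poly_eval_X mult.assoc nat_multiple_1_mult
    by (simp add: choose_two mult.commute)
  have cube: "(\<lambda>n. q_pochhammer q q n ^ 3) \<longlonglongrightarrow> L ^ 3"
    unfolding power3_eq_cube by (intro tendsto_mult L)
  show ?thesis
    unfolding t has_sum_def
  proof (rule topological_tendstoI)
    fix S assume "open S" "L ^ 3 \<in> S"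
    \<comment> \<open>Translating by L^3 gives a neighborhood of 0, in which an open subgroup can be
      found.\<close>
    define U where "U = (\<lambda>x. x + L ^ 3) -` S"
    have "open U"
      unfolding U_def using \<open>open S\<close> by (intro open_vimage continuous_intros)
    have "0 \<in> U"
      using \<open>L ^ 3 \<in> S\<close> by (simp add: U_def)
    obtain H where H: "open H" "0 \<in> H" "\<forall>x\<in>H. \<forall>y\<in>H. x + y \<in> H"
      "\<forall>x\<in>H. - x \<in> H" "H \<subseteq> U"
      using open_additive_subgroup[OF \<open>open U\<close> \<open>0 \<in> U\<close>] by blast
    obtain N where N: "\<And>p. ?X ^ N dvd p \<Longrightarrow> int_poly_eval q p \<in> H"
      using topologically_nilpotent_int_poly_eval[OF assms(1) H(1,2)] by metis
    have "(\<lambda>n. q_pochhammer q q n ^ 3 - L ^ 3) \<longlonglongrightarrow> 0"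
      using tendsto_diff[OF cube tendsto_const[of "L ^ 3"]] by simp
    then have "\<forall>\<^sub>F n in sequentially. q_pochhammer q q n ^ 3 - L ^ 3 \<in> H"
      using topological_tendstoD H(1,2) by blast
    \<comment> \<open>One n does both jobs: \<open>n \<ge> N\<close> makes the congruence and the
      tail negligible, and the cube of the partial product is within \<open>H\<close> of its limit.
      Hence \<open>{..n}\<close> is the threshold for finite sets.\<close>
    then obtain n where n: "n \<ge> N" "q_pochhammer q q n ^ 3 - L ^ 3 \<in> H"
      unfolding eventually_sequentially by (metis nle_le)
    show "\<forall>\<^sub>F F in finite_subsets_at_top UNIV. (\<Sum>k\<in>F. int_poly_eval q (t k)) \<in> S"
      unfolding eventually_finite_subsets_at_top
    proof (intro exI[of _ "{..n}"] conjI allI impI)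
      fix F assume "finite F \<and> {..n} \<subseteq> F \<and> F \<subseteq> UNIV"
      then have F: "finite F" "{..n} \<subseteq> F" by auto
      have tail: "?X ^ N dvd (\<Sum>k\<in>F - {..n}. t k)"
      proof (rule dvd_sum)
        fix k assume "k \<in> F - {..n}"
        \<comment> \<open>Here k > n \<ge> N, and k(k+1)/2 is at least k.\<close>
        with n(1) have "N \<le> Suc k choose 2" by (auto simp: numeral_2_eq_2)
        then show "?X ^ N dvd t k"
          unfolding t_def by (intro dvd_mult le_imp_power_dvd)
      qed
      have "?X ^ N dvd ?X ^ (n + 1)" using n(1) by (intro le_imp_power_dvd) simp
      then have "?X ^ N dvd q_pochhammer ?X ?X n ^ 3 - (\<Sum>k\<le>n. t k)"
        using jacobi_cong[OF X] unfolding t_def by (rule dvd_trans)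
      from dvd_diff[OF tail this]
      have "?X ^ N dvd (\<Sum>k\<in>F. t k) - q_pochhammer ?X ?X n ^ 3"
        by (simp add: sum.subset_diff[OF F(2,1)] algebra_simps)
      \<comment> \<open>The difference from L^3 is split at (q;q)_n^3; both parts lie in
        \<open>H\<close>, which is closed under addition.\<close>
      from H(3)[rule_format, OF N[OF this] n(2)] have "(\<Sum>k\<in>F. int_poly_eval q (t k)) - L ^ 3 \<in> H"
        by (simp add: int_poly_eval_diff int_poly_eval_power int_poly_eval_q_pochhammer int_poly_eval_sum)
      with H(5) show "(\<Sum>k\<in>F. int_poly_eval q (t k)) \<in> S"
        by (auto simp: U_def)
    qed simp_all
  qed
qed

theorem theorem6p1p2:
  fixes q :: "'a::complete_nonarchimedean_comm_ring"
  assumes "topologically_nilpotent q"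
  shows "convergent (\<lambda>n. q_pochhammer q q n)
    \<and> (\<lambda>k::nat. (- 1) ^ k * nat_multiple (2 * k + 1) (q ^ (k * (k + 1) div 2))) summable_on UNIV
    \<and> (q_pochhammer_inf q q) ^ 3
        = (\<Sum>\<^sub>\<infinity>k::nat. (- 1) ^ k * nat_multiple (2 * k + 1) (q ^ (k * (k + 1) div 2)))"
proof -
  obtain L where L: "(\<lambda>n. q_pochhammer q q n) \<longlonglongrightarrow> L"
    using convergent_q_pochhammer[OF assms] by (auto simp: convergent_def)
  then have "q_pochhammer_inf q q = L"
    unfolding q_pochhammer_inf_def by (rule limI)
  then show ?thesis
    using convergent_q_pochhammer[OF assms] jacobi_has_sum[OF assms L]
    by (auto simp: has_sum_imp_summable infsumI)
qed

end
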